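(* Let $\Omega\subset\mathbb{C}$ be a domain, let $\nu$ be a real-valued function in $\Omega$, and let $u$ be a (real-valued) solution of the stationary Schrödinger equation $(-\Delta+\nu)u=0$ in $\Omega$. Then its logarithmic derivative $$Q=\frac{u_z}{u}$$ is a solution of the complex differential Riccati equation $$\partial_{\overline z}Q+|Q|^2=\frac{\nu}{4}.$$
   Context: Here $z=x+iy$, $\partial_{\overline z}=\frac12(\partial_x+i\partial_y)$, $\partial_z=\frac12(\partial_x-i\partial_y)$, $u_z=\partial_z u$ and $\Delta=\partial_x^2+\partial_y^2$. Both equations are considered in $\Omega$. The function $Q$ is complex-valued and is not assumed to be analytic. *)

theory Defs
  imports "HOL-Analysis.Analysis"
begin

text \<open>
  Partial derivatives with respect to \<open>x\<close> and \<open>y\<close> of a function of \<open>z = x + \<i> y\<close>. They are genuine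
  two-sided derivatives along the coordinate directions, and at a point of an open set they only
  depend on the values of the function in that set. As usual for \<^const>\<open>vector_derivative\<close>, the
  value is meaningful only where the derivative exists; existence is part of \<open>C1_on\<close> below.
\<close>

definition partial_x :: "(complex \<Rightarrow> 'a::real_normed_vector) \<Rightarrow> complex \<Rightarrow> 'a" where
  "partial_x f z = vector_derivative (\<lambda>t. f (z + of_real t)) (at 0)"

definition partial_y :: "(complex \<Rightarrow> 'a::real_normed_vector) \<Rightarrow> complex \<Rightarrow> 'a" where
  "partial_y f z = vector_derivative (\<lambda>t. f (z + \<i> * of_real t)) (at 0)"

definition C1_on :: "complex set \<Rightarrow> (complex \<Rightarrow> 'a::real_normed_vector) \<Rightarrow> bool" where
  "C1_on S f \<longleftrightarrow>
     (\<forall>z\<in>S. (\<lambda>t::real. f (z + of_real t)) differentiable (at 0) \<and>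
            (\<lambda>t::real. f (z + \<i> * of_real t)) differentiable (at 0)) \<and>
     continuous_on S (partial_x f) \<and> continuous_on S (partial_y f)"

definition C2_on :: "complex set \<Rightarrow> (complex \<Rightarrow> 'a::real_normed_vector) \<Rightarrow> bool" where
  "C2_on S f \<longleftrightarrow> C1_on S f \<and> C1_on S (partial_x f) \<and> C1_on S (partial_y f)"

definition laplacian :: "(complex \<Rightarrow> 'a::real_normed_vector) \<Rightarrow> complex \<Rightarrow> 'a" where
  "laplacian f z = partial_x (partial_x f) z + partial_y (partial_y f) z"

definition d_z :: "(complex \<Rightarrow> complex) \<Rightarrow> complex \<Rightarrow> complex" where
  "d_z f z = (1 / 2) * (partial_x f z - \<i> * partial_y f z)"

definition d_zbar :: "(complex \<Rightarrow> complex) \<Rightarrow> complex \<Rightarrow> complex" where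
  "d_zbar f z = (1 / 2) * (partial_x f z + \<i> * partial_y f z)"

text \<open>Solutions are understood in the classical sense, on an open set \<open>S\<close>.\<close>

definition schroedinger_solution_on ::
    "complex set \<Rightarrow> (complex \<Rightarrow> real) \<Rightarrow> (complex \<Rightarrow> real) \<Rightarrow> bool" where
  "schroedinger_solution_on S \<nu> u \<longleftrightarrow>
     C2_on S u \<and> (\<forall>z\<in>S. - laplacian u z + \<nu> z * u z = 0)"

definition riccati_solution_on ::
    "complex set \<Rightarrow> (complex \<Rightarrow> real) \<Rightarrow> (complex \<Rightarrow> complex) \<Rightarrow> bool" where
  "riccati_solution_on S \<nu> Q \<longleftrightarrow>
     C1_on S Q \<and> (\<forall>z\<in>S. d_zbar Q z + of_real ((cmod (Q z))\<^sup>2) = of_real (\<nu> z) / 4)"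

text \<open>
  The logarithmic derivative \<open>u\<^sub>z / u\<close>. It is meaningful only where \<open>u\<close> does not vanish; at a zero
  of \<open>u\<close> the total division of HOL returns the junk value \<open>0\<close>.
\<close>

definition log_derivative :: "(complex \<Rightarrow> real) \<Rightarrow> complex \<Rightarrow> complex" where
  "log_derivative u z = d_z (\<lambda>w. of_real (u w)) z / of_real (u z)"

end

theory Submission
  imports Defs
begin

text \<open>
  Write \<open>P = u\<^sub>z\<close>. The quotient rule gives \<open>Q\<^sub>z\<^sub>b\<^sub>a\<^sub>r = P\<^sub>z\<^sub>b\<^sub>a\<^sub>r / u - Q * u\<^sub>z\<^sub>b\<^sub>a\<^sub>r / u\<close>. Since \<open>u\<close> is real,
  \<open>u\<^sub>z\<^sub>b\<^sub>a\<^sub>r / u\<close> is the conjugate of \<open>Q\<close>, and since the mixed partials of \<open>u\<close> agree,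
  \<open>4 * P\<^sub>z\<^sub>b\<^sub>a\<^sub>r\<close> is the Laplacian \<open>\<nu> * u\<close>.
\<close>

section \<open>Directional derivatives and the C1 condition\<close>

text \<open>Existence and value are bundled in one predicate, and the direction \<open>e\<close> is
  a parameter, so that one argument serves both partials: \<open>e = 1\<close> for x and
  \<open>e = \<i>\<close> for y.\<close>

definition has_directional_derivative ::
    "(complex \<Rightarrow> 'a::real_normed_vector) \<Rightarrow> 'a \<Rightarrow> complex \<Rightarrow> complex \<Rightarrow> bool" where
  "has_directional_derivative f D e z \<longleftrightarrow>
     ((\<lambda>t. f (z + e * of_real t)) has_vector_derivative D) (at 0)"

lemma partial_x_eqI: "has_directional_derivative f D 1 z \<Longrightarrow> partial_x f z = D"
  by (simp add: has_directional_derivative_def partial_x_def vector_derivative_at)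

lemma partial_y_eqI: "has_directional_derivative f D \<i> z \<Longrightarrow> partial_y f z = D"
  by (simp add: has_directional_derivative_def partial_y_def vector_derivative_at)

lemma C1_on_iff:
  "C1_on S f \<longleftrightarrow>
     (\<forall>z\<in>S. has_directional_derivative f (partial_x f z) 1 z \<and>
            has_directional_derivative f (partial_y f z) \<i> z) \<and>
     continuous_on S (partial_x f) \<and> continuous_on S (partial_y f)"
  by (simp add: C1_on_def has_directional_derivative_def partial_x_def partial_y_def
        vector_derivative_works)

text \<open>Continuity can be checked on explicit candidates, because they agree with the partials
  at every point of \<open>S\<close> and continuity on \<open>S\<close> sees no other
  values.\<close>

lemma C1_onI:
  assumes "\<And>z. z \<in> S \<Longrightarrow> has_directional_derivative f (fx z) 1 z"
    and "\<And>z. z \<in> S \<Longrightarrow> has_directional_derivative f (fy z) \<i> z"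
    and "continuous_on S fx" and "continuous_on S fy"
  shows "C1_on S f"
proof -
  have "partial_x f z = fx z" "partial_y f z = fy z" if "z \<in> S" for z
    using assms(1,2) that by (auto intro: partial_x_eqI partial_y_eqI)
  then show ?thesis
    unfolding C1_on_iff using assms
    by (auto cong: continuous_on_cong_simp)
qed

section \<open>Mean value bounds and continuity of C1 functions\<close>

text \<open>The predicate differentiates at parameter 0 only; shifting the parameter gives the
  derivative at every point of a fixed line, as mean value arguments require.\<close>

lemma has_directional_derivative_along_line:
  assumes "has_directional_derivative f D e (z + e * of_real t)"
  shows "((\<lambda>s. f (z + e * of_real s)) has_vector_derivative D) (at t)"
proof -
  \<comment> \<open>The point 0 is written \<open>t - t\<close> to match the value at
    \<open>t\<close> of the inner map \<open>s - t\<close> in the chain rule.\<close>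
  have "((\<lambda>s. f (z + e * of_real t + e * of_real s)) has_vector_derivative D) (at (t - t))"
    using assms by (simp add: has_directional_derivative_def)
  moreover have "((\<lambda>s. s - t) has_vector_derivative 1) (at t)"
    by (auto intro!: derivative_eq_intros)
  ultimately have "((\<lambda>s. f (z + e * of_real t + e * of_real s)) \<circ> (\<lambda>s. s - t)
      has_vector_derivative 1 *\<^sub>R D) (at t)"
    by (intro vector_diff_chain_at) auto
  then show ?thesis
    by (simp add: o_def algebra_simps)
qed

lemma directional_mean_value_bound:
  fixes f :: "complex \<Rightarrow> 'a::real_normed_vector"
  assumes "\<And>s. s \<in> closed_segment 0 t \<Longrightarrow>
      has_directional_derivative f (f' s) e (z + e * of_real s)"
    and "\<And>s. s \<in> closed_segment 0 t \<Longrightarrow> norm (f' s) \<le> B"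
  shows "norm (f (z + e * of_real t) - f z) \<le> B * \<bar>t\<bar>"
proof -
  have "norm (f (z + e * of_real t) - f (z + e * of_real 0)) \<le> B * norm (t - 0)"
  proof (rule differentiable_bound[where f' = "\<lambda>s h. h *\<^sub>R f' s" and S = "closed_segment 0 t"])
    fix s assume s: "s \<in> closed_segment 0 t"
    show "((\<lambda>s. f (z + e * of_real s)) has_derivative (\<lambda>h. h *\<^sub>R f' s)) (at s within closed_segment 0 t)"
      using has_directional_derivative_along_line[OF assms(1)[OF s]]
      by (auto simp: has_vector_derivative_def intro: has_derivative_at_withinI)
    show "onorm (\<lambda>h. h *\<^sub>R f' s) \<le> B"
      using assms(2)[OF s] by (intro onorm_bound) (auto simp: mult.commute[of B] mult_left_mono
          intro: order_trans[OF norm_ge_zero])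
  qed auto
  then show ?thesis by simp
qed

text \<open>\<open>C1_on\<close> only speaks of the two axis directions, so continuity needs an
  argument. The partials are bounded near \<open>z\<close>, and a horizontal leg followed by a
  vertical one bounds the increment of \<open>f\<close> by a multiple of the distance.\<close>

lemma C1_on_imp_continuous_on:
  fixes f :: "complex \<Rightarrow> 'a::real_normed_vector"
  assumes "open S" "C1_on S f"
  shows "continuous_on S f"
proof (subst continuous_on_eq_continuous_at[OF \<open>open S\<close>], intro ballI)
  fix z assume "z \<in> S"
  define g where "g w = norm (partial_x f w) + norm (partial_y f w)" for w
  have "continuous_on S g"
    using assms unfolding g_def by (auto simp: C1_on_def intro!: continuous_intros)
  then have "isCont g z"
    using assms \<open>z \<in> S\<close> by (simp add: continuous_on_eq_continuous_at)
  then have "(g \<longlongrightarrow> g z) (nhds z)"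
    by (simp add: isCont_def tendsto_at_iff_tendsto_nhds)
  then have "\<forall>\<^sub>F w in nhds z. g w < g z + 1"
    by (rule order_tendstoD) simp
  moreover have "\<forall>\<^sub>F w in nhds z. w \<in> S"
    using assms \<open>z \<in> S\<close> by (simp add: eventually_nhds_in_open)
  ultimately have "\<forall>\<^sub>F w in nhds z. w \<in> S \<and> g w < g z + 1"
    by eventually_elim auto
  then obtain r where r: "r > 0" and g: "\<And>w. dist w z < r \<Longrightarrow> w \<in> S \<and> g w < g z + 1"
    unfolding eventually_nhds_metric by blast
  define B where "B = g z + 1"
  have B: "w \<in> S" "norm (partial_x f w) \<le> B" "norm (partial_y f w) \<le> B" if "dist w z < r" for w
    using g[OF that] norm_ge_zero[of "partial_x f w"] norm_ge_zero[of "partial_y f w"]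
    unfolding B_def g_def[of w] by linarith+
  have bound: "norm (f w - f z) \<le> 2 * B * norm (w - z)" if w: "dist w z < r" for w
  proof -
    define a b where "a = Re (w - z)" and "b = Im (w - z)"
    have w_eq: "w = z + of_real a + \<i> * of_real b"
      by (simp add: a_def b_def complex_eq_iff)
    have ab: "\<bar>a\<bar> \<le> norm (w - z)" "\<bar>b\<bar> \<le> norm (w - z)"
      by (simp_all only: a_def b_def abs_Re_le_cmod abs_Im_le_cmod)
    have X: "dist (z + of_real s) z < r" if "s \<in> closed_segment 0 a" for s
      using that w ab by (auto simp: dist_norm closed_segment_eq_real_ivl split: if_splits)
    \<comment> \<open>On the vertical leg \<open>s\<close> lies between 0 and \<open>b\<close>, so
      no point of it is farther from \<open>z\<close> than \<open>w\<close> is.\<close>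
    have Y: "dist (z + of_real a + \<i> * of_real s) z < r" if "s \<in> closed_segment 0 b" for s
    proof -
      have "s\<^sup>2 \<le> b\<^sup>2"
        using that by (intro power2_le_iff_abs_le[THEN iffD2] abs_le_square_iff[THEN iffD1])
          (auto simp: closed_segment_eq_real_ivl split: if_splits)
      then have "norm (of_real a + \<i> * of_real s) \<le> norm (of_real a + \<i> * of_real b)"
        by (simp add: cmod_def)
      then show ?thesis
        using w by (simp add: dist_norm w_eq add.assoc)
    qed
    have "norm (f (z + 1 * of_real a) - f z) \<le> B * \<bar>a\<bar>"
    proof (rule directional_mean_value_bound)
      fix s assume "s \<in> closed_segment 0 a"
      from B[OF X[OF this]]
      show "has_directional_derivative f (partial_x f (z + 1 * of_real s)) 1 (z + 1 * of_real s)"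
        "norm (partial_x f (z + 1 * of_real s)) \<le> B"
        using assms(2) by (auto simp: C1_on_iff)
    qed
    moreover have "norm (f (z + of_real a + \<i> * of_real b) - f (z + of_real a)) \<le> B * \<bar>b\<bar>"
    proof (rule directional_mean_value_bound)
      fix s assume "s \<in> closed_segment 0 b"
      from B[OF Y[OF this]]
      show "has_directional_derivative f (partial_y f (z + of_real a + \<i> * of_real s)) \<i>
          (z + of_real a + \<i> * of_real s)"
        "norm (partial_y f (z + of_real a + \<i> * of_real s)) \<le> B"
        using assms(2) by (auto simp: C1_on_iff)
    qed
    moreover have "norm (f w - f z) \<le> norm (f w - f (z + of_real a)) + norm (f (z + of_real a) - f z)"
      using norm_triangle_ineq[of "f w - f (z + of_real a)" "f (z + of_real a) - f z"] by simp
    moreover have "B \<ge> 0"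
      by (simp add: B_def g_def)
    then have "B * \<bar>a\<bar> \<le> B * norm (w - z)" "B * \<bar>b\<bar> \<le> B * norm (w - z)"
      using ab by (auto intro!: mult_left_mono)
    ultimately show ?thesis by (simp add: w_eq)
  qed
  have "((\<lambda>w. f w - f z) \<longlongrightarrow> 0) (at z)"
  proof (rule Lim_null_comparison)
    show "\<forall>\<^sub>F w in at z. norm (f w - f z) \<le> 2 * B * norm (w - z)"
      using bound r by (auto simp: eventually_at intro!: exI[of _ r])
    show "((\<lambda>w. 2 * B * norm (w - z)) \<longlongrightarrow> 0) (at z)"
      by (auto intro!: tendsto_eq_intros)
  qed
  then show "isCont f z"
    by (simp add: isCont_def LIM_zero_iff)
qed

section \<open>Symmetry of the mixed second partials\<close>

text \<open>The mean value theorem is used twice: in the first variable for the difference of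
  \<open>\<phi>\<close> between \<open>k\<close> and 0, then in the second variable for
  \<open>\<phi>\<^sub>1 s\<close>.\<close>

lemma double_difference_mean_value:
  fixes \<phi> \<phi>\<^sub>1 \<phi>\<^sub>1\<^sub>2 :: "real \<Rightarrow> real \<Rightarrow> real"
  assumes "h > 0" "k > 0"
    and 1: "\<And>s t. \<lbrakk>0 \<le> s; s \<le> h; 0 \<le> t; t \<le> k\<rbrakk> \<Longrightarrow> ((\<lambda>s. \<phi> s t) has_real_derivative \<phi>\<^sub>1 s t) (at s)"
    and 2: "\<And>s t. \<lbrakk>0 \<le> s; s \<le> h; 0 \<le> t; t \<le> k\<rbrakk> \<Longrightarrow> ((\<lambda>t. \<phi>\<^sub>1 s t) has_real_derivative \<phi>\<^sub>1\<^sub>2 s t) (at t)"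
  obtains s t where "0 < s" "s < h" "0 < t" "t < k"
    "\<phi> h k - \<phi> h 0 - \<phi> 0 k + \<phi> 0 0 = h * k * \<phi>\<^sub>1\<^sub>2 s t"
proof -
  have "\<exists>s>0. s < h \<and> (\<phi> h k - \<phi> h 0) - (\<phi> 0 k - \<phi> 0 0) = (h - 0) * (\<phi>\<^sub>1 s k - \<phi>\<^sub>1 s 0)"
    using assms by (intro MVT2[where f = "\<lambda>s. \<phi> s k - \<phi> s 0"]) (auto intro!: DERIV_diff)
  then obtain s where s: "0 < s" "s < h"
    "(\<phi> h k - \<phi> h 0) - (\<phi> 0 k - \<phi> 0 0) = h * (\<phi>\<^sub>1 s k - \<phi>\<^sub>1 s 0)"
    by auto
  have "\<exists>t>0. t < k \<and> \<phi>\<^sub>1 s k - \<phi>\<^sub>1 s 0 = (k - 0) * \<phi>\<^sub>1\<^sub>2 s t"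
    using assms s by (intro MVT2) auto
  then show thesis
    using s that by (auto simp: algebra_simps)
qed

text \<open>Schwarz's theorem: the two mixed partials take a common value at points arbitrarily
  close to \<open>z\<close>, and their continuity carries the equality to \<open>z\<close>
  itself.\<close>

lemma C2_on_partials_commute:
  fixes u :: "complex \<Rightarrow> real"
  assumes "open S" "C2_on S u" "z \<in> S"
  shows "partial_y (partial_x u) z = partial_x (partial_y u) z"
proof -
  obtain r where r: "r > 0" "ball z r \<subseteq> S"
    using assms open_contains_ball by blast
  define c where "c s t = z + of_real s + \<i> * of_real t" for s t
  \<comment> \<open>Side \<open>d / 3\<close> keeps the whole square in the open ball, since the two
    legs add up to at most \<open>2 * d / 3\<close>.\<close>
  have c: "c s t \<in> ball z d" if "0 \<le> s" "s \<le> d / 3" "0 \<le> t" "t \<le> d / 3" "d > 0" for s t d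
  proof -
    have "norm (c s t - z) \<le> norm (of_real s :: complex) + norm (\<i> * of_real t)"
      unfolding c_def by (metis add.assoc add_diff_cancel_left' norm_triangle_ineq)
    then show ?thesis
      using that by (simp add: dist_norm norm_minus_commute norm_mult)
  qed
  have dx: "((\<lambda>s. f (c s t)) has_real_derivative partial_x f (c s t)) (at s)"
    if "C1_on S f" "c s t \<in> S" for f s t
    using has_directional_derivative_along_line[of f "partial_x f (c s t)" 1 "z + \<i> * of_real t" s] that
    by (simp add: C1_on_iff c_def has_real_derivative_iff_has_vector_derivative algebra_simps)
  have dy: "((\<lambda>t. f (c s t)) has_real_derivative partial_y f (c s t)) (at t)"
    if "C1_on S f" "c s t \<in> S" for f s t
    using has_directional_derivative_along_line[of f "partial_y f (c s t)" \<i> "z + of_real s" t] that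
    by (simp add: C1_on_iff c_def has_real_derivative_iff_has_vector_derivative algebra_simps)
  \<comment> \<open>The same double difference of \<open>u\<close> over a small square is a value of either mixed partial.\<close>
  have near: "\<exists>p\<in>ball z d. \<exists>q\<in>ball z d. partial_y (partial_x u) p = partial_x (partial_y u) q"
    if "0 < d" "d \<le> r" for d
  proof -
    have cS: "c s t \<in> S" if "0 \<le> s" "s \<le> d / 3" "0 \<le> t" "t \<le> d / 3" for s t
      using c[OF that \<open>0 < d\<close>] \<open>d \<le> r\<close> r by auto
    obtain s t where st: "0 < s" "s < d / 3" "0 < t" "t < d / 3"
      "u (c (d/3) (d/3)) - u (c (d/3) 0) - u (c 0 (d/3)) + u (c 0 0)
        = d / 3 * (d / 3) * partial_y (partial_x u) (c s t)"
      using double_difference_mean_value[of "d/3" "d/3" "\<lambda>s t. u (c s t)"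
          "\<lambda>s t. partial_x u (c s t)" "\<lambda>s t. partial_y (partial_x u) (c s t)"]
        \<open>0 < d\<close> assms(2) dx dy cS unfolding C2_on_def by auto
    obtain t' s' where st': "0 < t'" "t' < d / 3" "0 < s'" "s' < d / 3"
      "u (c (d/3) (d/3)) - u (c 0 (d/3)) - u (c (d/3) 0) + u (c 0 0)
        = d / 3 * (d / 3) * partial_x (partial_y u) (c s' t')"
      using double_difference_mean_value[of "d/3" "d/3" "\<lambda>t s. u (c s t)"
          "\<lambda>t s. partial_y u (c s t)" "\<lambda>t s. partial_x (partial_y u) (c s t)"]
        \<open>0 < d\<close> assms(2) dx dy cS unfolding C2_on_def by auto
    have "d / 3 * (d / 3) * partial_y (partial_x u) (c s t)
        = d / 3 * (d / 3) * partial_x (partial_y u) (c s' t')"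
      using st(5) st'(5) by linarith
    then show ?thesis
      using \<open>0 < d\<close> c[of s d t] c[of s' d t'] st st' by (auto intro!: bexI)
  qed
  \<comment> \<open>Radii tending to 0; \<open>Suc n\<close> keeps the denominator at least 1, hence
    \<open>X n \<le> r\<close> as \<open>near\<close> demands.\<close>
  define X where "X n = r / real (Suc n)" for n
  have X: "0 < X n" "X n \<le> r" for n
    using r by (auto simp: X_def field_simps)
  have X0: "X \<longlonglongrightarrow> 0"
    unfolding X_def using LIMSEQ_Suc[OF lim_const_over_n[of r]] by simp
  obtain p q where p: "\<And>n. p n \<in> ball z (X n)" and q: "\<And>n. q n \<in> ball z (X n)"
    and pq: "\<And>n. partial_y (partial_x u) (p n) = partial_x (partial_y u) (q n)"
    using near[OF X] by metis
  have lim: "y \<longlonglongrightarrow> z" if "\<And>n. y n \<in> ball z (X n)" for y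
    using that by (intro metric_tendsto_imp_tendsto[OF X0] always_eventually allI)
      (auto simp: dist_commute less_imp_le intro: order_trans[OF less_imp_le abs_ge_self])
  have "isCont (partial_y (partial_x u)) z" "isCont (partial_x (partial_y u)) z"
    using assms by (auto simp: C2_on_def C1_on_def continuous_on_eq_continuous_at)
  then have "(\<lambda>n. partial_y (partial_x u) (p n)) \<longlonglongrightarrow> partial_y (partial_x u) z"
    "(\<lambda>n. partial_x (partial_y u) (q n)) \<longlonglongrightarrow> partial_x (partial_y u) z"
    using lim[OF p] lim[OF q] by (auto intro: isCont_tendsto_compose)
  then show ?thesis
    using LIMSEQ_unique by (simp add: pq)
qed

section \<open>Differentiating the logarithmic derivative\<close>

lemma d_z_of_real:
  assumes "C1_on S u" "z \<in> S"
  shows "d_z (\<lambda>w. of_real (u w)) z = (of_real (partial_x u z) - \<i> * of_real (partial_y u z)) / 2"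
proof -
  have "has_directional_derivative (\<lambda>w. complex_of_real (u w)) (of_real D) e z"
    if "has_directional_derivative u D e z" for D e
    using that has_vector_derivative_of_real
    unfolding has_directional_derivative_def has_real_derivative_iff_has_vector_derivative
    by blast
  then have "partial_x (\<lambda>w. complex_of_real (u w)) z = of_real (partial_x u z)"
    "partial_y (\<lambda>w. complex_of_real (u w)) z = of_real (partial_y u z)"
    using assms by (auto simp: C1_on_iff intro!: partial_x_eqI partial_y_eqI)
  then show ?thesis by (simp add: d_z_def)
qed

text \<open>The quotient rule for \<open>u_z / u\<close> along a general real direction, with the
  quotient itself put back as \<open>log_derivative u z\<close> so that the Riccati term is already
  visible.\<close>

lemma log_derivative_has_directional_derivative:
  assumes "open S" "C1_on S u" "z \<in> S" "u z \<noteq> 0"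
    and u: "has_directional_derivative u u\<^sub>e e z"
    and x: "has_directional_derivative (partial_x u) x\<^sub>e e z"
    and y: "has_directional_derivative (partial_y u) y\<^sub>e e z"
  shows "has_directional_derivative (log_derivative u)
    ((of_real x\<^sub>e - \<i> * of_real y\<^sub>e) / (2 * of_real (u z)) -
     log_derivative u z * of_real u\<^sub>e / of_real (u z)) e z"
proof -
  let ?l = "\<lambda>t::real. z + e * of_real t"
  let ?P = "\<lambda>w. complex_of_real (partial_x u w) - \<i> * of_real (partial_y u w)"
  have eq: "log_derivative u w = ?P w / (2 * of_real (u w))" if "w \<in> S" for w
    using d_z_of_real[OF assms(2) that] by (simp only: log_derivative_def divide_divide_eq_left)
  have real: "((\<lambda>t. complex_of_real (f (?l t))) has_derivative (\<lambda>t. of_real (t * D))) (at 0)"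
    if "has_directional_derivative f D e z" for f D
    using that unfolding has_directional_derivative_def has_vector_derivative_def
    by (auto dest: has_derivative_of_real)
  have "((\<lambda>t. ?P (?l t) / (2 * of_real (u (?l t)))) has_vector_derivative
     (of_real x\<^sub>e - \<i> * of_real y\<^sub>e) / (2 * of_real (u z)) -
     log_derivative u z * of_real u\<^sub>e / of_real (u z)) (at 0)"
    unfolding has_vector_derivative_def
  proof (rule has_derivative_eq_rhs)
    show "((\<lambda>t. ?P (?l t) / (2 * of_real (u (?l t)))) has_derivative
      (\<lambda>t. ((of_real (t * x\<^sub>e) - \<i> * of_real (t * y\<^sub>e)) * (2 * of_real (u (?l 0))) -
        ?P (?l 0) * (2 * of_real (t * u\<^sub>e))) /
        ((2 * of_real (u (?l 0))) * (2 * of_real (u (?l 0)))))) (at 0)"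
      using assms(4)
      by (intro has_derivative_divide' has_derivative_diff has_derivative_mult_right
          real[OF u] real[OF x] real[OF y]) auto
  qed (use assms(4) in \<open>auto simp: eq[OF assms(3)] fun_eq_iff scaleR_conv_of_real field_simps\<close>)
  \<comment> \<open>The explicit quotient equals \<open>log_derivative u\<close> only on
    \<open>S\<close>; openness of the preimage makes them agree for all parameters near 0.\<close>
  moreover have "open (?l -` S)"
    by (intro open_vimage assms continuous_intros)
  ultimately have "((\<lambda>t. log_derivative u (?l t)) has_vector_derivative
     (of_real x\<^sub>e - \<i> * of_real y\<^sub>e) / (2 * of_real (u z)) -
     log_derivative u z * of_real u\<^sub>e / of_real (u z)) (at 0)"
    by (rule has_vector_derivative_transform_within_open) (auto simp: assms eq)
  then show ?thesis by (simp add: has_directional_derivative_def)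
qed

section \<open>The Riccati equation off the zeros of \<open>u\<close>\<close>

theorem theorem5:
  fixes \<Omega> :: "complex set" and \<nu> u :: "complex \<Rightarrow> real"
  assumes "open \<Omega>" and "connected \<Omega>" and "\<Omega> \<noteq> {}"
    and "schroedinger_solution_on \<Omega> \<nu> u"
  shows "riccati_solution_on {z \<in> \<Omega>. u z \<noteq> 0} \<nu> (log_derivative u)"
proof -
  let ?S = "{z \<in> \<Omega>. u z \<noteq> 0}" and ?Q = "log_derivative u"
  have C2: "C2_on \<Omega> u" and eqn: "\<And>z. z \<in> \<Omega> \<Longrightarrow> laplacian u z = \<nu> z * u z"
    using assms(4) by (auto simp: schroedinger_solution_on_def)
  then have C1: "C1_on \<Omega> u" "C1_on \<Omega> (partial_x u)" "C1_on \<Omega> (partial_y u)"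
    by (auto simp: C2_on_def)
  \<comment> \<open>The result of the quotient rule with the operator \<open>D\<close> left open, to
    be taken as \<open>partial_x\<close> or \<open>partial_y\<close>.\<close>
  define Q' where "Q' D z =
    (complex_of_real (D (partial_x u) z) - \<i> * of_real (D (partial_y u) z)) / (2 * of_real (u z)) -
    ?Q z * of_real (D u z) / of_real (u z)" for D :: "(complex \<Rightarrow> real) \<Rightarrow> complex \<Rightarrow> real" and z
  have Q: "?Q z = (of_real (partial_x u z) - \<i> * of_real (partial_y u z)) / (2 * of_real (u z))"
    if "z \<in> \<Omega>" for z
    using d_z_of_real[OF C1(1) that] by (simp only: log_derivative_def divide_divide_eq_left)
  have Qx: "has_directional_derivative ?Q (Q' partial_x z) 1 z"
    and Qy: "has_directional_derivative ?Q (Q' partial_y z) \<i> z" if "z \<in> ?S" for z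
    unfolding Q'_def using that C1
    by (auto intro!: log_derivative_has_directional_derivative[OF assms(1) C1(1)] simp: C1_on_iff)
  have cont: "continuous_on ?S f" if "continuous_on \<Omega> f" for f :: "complex \<Rightarrow> real"
    using that by (rule continuous_on_subset) auto
  note [continuous_intros] =
    C1(1)[THEN C1_on_imp_continuous_on[OF assms(1)], THEN cont]
    C1(2)[THEN C1_on_imp_continuous_on[OF assms(1)], THEN cont]
    C1(3)[THEN C1_on_imp_continuous_on[OF assms(1)], THEN cont]
  have contQ: "continuous_on ?S ?Q"
    by (subst continuous_on_cong[OF refl Q]) (auto intro!: continuous_intros)
  have "continuous_on ?S (Q' partial_x)" "continuous_on ?S (Q' partial_y)"
    unfolding Q'_def using C1
    by (auto intro!: continuous_intros contQ cont simp: C1_on_def)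
  with Qx Qy have "C1_on ?S ?Q"
    by (intro C1_onI)
  moreover have "d_zbar ?Q z + of_real ((cmod (?Q z))\<^sup>2) = of_real (\<nu> z) / 4" if z: "z \<in> ?S" for z
  proof -
    have "d_zbar ?Q z = (Q' partial_x z + \<i> * Q' partial_y z) / 2"
      by (simp add: d_zbar_def partial_x_eqI[OF Qx[OF z]] partial_y_eqI[OF Qy[OF z]])
    \<comment> \<open>The mixed partials enter with factors \<open>- \<i>\<close> and
      \<open>\<i>\<close> and cancel by symmetry; the pure ones add up to the Laplacian.\<close>
    also have "\<dots> = of_real (laplacian u z) / (4 * of_real (u z)) -
        ?Q z * ((of_real (partial_x u z) + \<i> * of_real (partial_y u z)) / (2 * of_real (u z)))"
      using z C2_on_partials_commute[OF assms(1) C2, of z]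
      by (simp add: Q'_def laplacian_def field_simps)
    also have "(of_real (partial_x u z) + \<i> * of_real (partial_y u z)) / (2 * of_real (u z)) = cnj (?Q z)"
      using z by (simp add: Q)
    also have "of_real (laplacian u z) / (4 * of_real (u z)) = (of_real (\<nu> z) / 4 :: complex)"
      using z by (simp add: eqn)
    \<comment> \<open>The subtracted product \<open>?Q z * cnj (?Q z)\<close> is the squared
      modulus, so adding the latter leaves only the potential term.\<close>
    finally show ?thesis
      by (simp only: complex_norm_square diff_add_cancel)
  qed
  ultimately show ?thesis
    by (simp add: riccati_solution_on_def)
qed

end
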